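(* Fix $\hbar\in\mathbb C^*$. On the four-dimensional space with coordinates $(a,w,q,v)$ let $V$ be the vector field $$V=\frac{\partial}{\partial w}+\frac1{A(w)}\Big(\kappa\frac{\partial}{\partial q}+\big(q(q-1)S'(q)-v\big)\frac{\partial}{\partial v}\Big)+\frac1{\hbar A(w)}\Big(2pq(q-1)\frac{\partial}{\partial q}+\Big(q(q-1)R'(q)-p-\frac{Q_0'(q)\kappa}{2p}-A(w)\frac{\partial p}{\partial w}\Big)\frac{\partial}{\partial v}\Big).$$ Then the flow generated by $V$ is the Painlevé VI equation: along any integral curve of $V$, parametrised by $w$, the function $q=q(w)$ satisfies $$\frac{d^2q}{dw^2}=\frac12\Big(\frac1q+\frac1{q-1}+\frac1{q-w}\Big)\Big(\frac{dq}{dw}\Big)^2-\Big(\frac1w+\frac1{w-1}+\frac1{q-w}\Big)\frac{dq}{dw}+\frac12\frac{q(q-1)(q-w)}{w^2(w-1)^2}\Big(1-\frac{w}{q^2}+\frac{w-1}{(q-1)^2}\Big).$$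
   Context: Here $a,w\in\mathbb C$ with $aw(w-1)\neq0$, $$Q_0(x)=\frac{a(w-1)}{x}-\frac{aw}{x-1}+\frac{a}{x-w},$$ $q\in\mathbb C\setminus\{0,1,w\}$, $p$ is a (locally chosen) square root $p^2=Q_0(q)$, regarded as a function of $(a,w,q)$ with $\partial p/\partial w$ its partial derivative at fixed $a,q$, and $v\in\mathbb C$. Further $$R(x)=\frac{-px^2+p(1+w-q)x+2pq^2-pq(1+w)+2pvq(q-1)(q-w)}{x(x-1)(x-w)},$$ $$S(x)=\frac{-vx^2+\big(v(1+w-q)-\frac34\big)x+v^2q(q-1)(q-w)+q\big(v(2q-w-1)+\frac34\big)}{x(x-1)(x-w)},$$ $$A(x)=\frac{x(x-1)}{x-q},\qquad A(w)=\frac{w(w-1)}{w-q},\qquad \kappa=2vq(q-1)+2q-1,$$ and $Q_0',R',S'$ denote derivatives with respect to $x$. ($V$ generates isomonodromic deformations of $Y''=Q(x)Y$ with $Q=\hbar^{-2}Q_0+\hbar^{-1}\big(\frac{p}{x-q}+R\big)+\frac{3}{4(x-q)^2}+\frac{v}{x-q}+S$.) *)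

theory Defs
  imports "HOL-Analysis.Analysis"
begin

definition Q0 :: "complex \<Rightarrow> complex \<Rightarrow> complex \<Rightarrow> complex" where
  "Q0 a w x = a * (w - 1) / x - a * w / (x - 1) + a / (x - w)"

definition Rfun :: "complex \<Rightarrow> complex \<Rightarrow> complex \<Rightarrow> complex \<Rightarrow> complex \<Rightarrow> complex" where
  "Rfun p w q v x =
     (- p * x^2 + p * (1 + w - q) * x + 2 * p * q^2 - p * q * (1 + w)
        + 2 * p * v * q * (q - 1) * (q - w))
     / (x * (x - 1) * (x - w))"

definition Sfun :: "complex \<Rightarrow> complex \<Rightarrow> complex \<Rightarrow> complex \<Rightarrow> complex" where
  "Sfun w q v x =
     (- v * x^2 + (v * (1 + w - q) - 3/4) * x + v^2 * q * (q - 1) * (q - w)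
        + q * (v * (2 * q - w - 1) + 3/4))
     / (x * (x - 1) * (x - w))"

definition Afun :: "complex \<Rightarrow> complex \<Rightarrow> complex" where
  "Afun q x = x * (x - 1) / (x - q)"

definition kappa :: "complex \<Rightarrow> complex \<Rightarrow> complex" where
  "kappa q v = 2 * v * q * (q - 1) + 2 * q - 1"

definition parameter_space :: "(complex \<times> complex \<times> complex) set" where
  "parameter_space = {(a, w, q). a * w * (w - 1) \<noteq> 0 \<and> q \<notin> {0, 1, w}}"

text \<open>
  The local choice of the square root \<open>p\<close> of \<open>Q0(q)\<close>, as a function of \<open>(a, w, q)\<close>.
  Since \<open>Q0(q)\<close> is holomorphic and nowhere zero on the parameter space, a continuous
  branch is automatically holomorphic, so its partial derivatives exist.
\<close>

definition sqrt_branch ::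
    "(complex \<times> complex \<times> complex) set \<Rightarrow> (complex \<times> complex \<times> complex \<Rightarrow> complex) \<Rightarrow> bool" where
  "sqrt_branch U p \<longleftrightarrow>
     open U \<and> U \<subseteq> parameter_space \<and> continuous_on U p \<and>
     (\<forall>(a, w, q) \<in> U. (p (a, w, q))^2 = Q0 a w q)"

text \<open>
  The components of the vector field in the coordinates \<open>(a, w, q, v)\<close>.
  In \<open>R'(q)\<close> and \<open>S'(q)\<close> only the argument \<open>x\<close> is differentiated, the parameters
  (including \<open>p\<close> and the parameter \<open>q\<close>) being held fixed.
\<close>

definition V ::
    "complex \<Rightarrow> (complex \<times> complex \<times> complex \<Rightarrow> complex) \<Rightarrow>
     complex \<times> complex \<times> complex \<times> complex \<Rightarrow> complex \<times> complex \<times> complex \<times> complex" where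
  "V hbar P = (\<lambda>(a, w, q, v).
     let p = P (a, w, q);
         dp_dw = deriv (\<lambda>w'. P (a, w', q)) w;
         Aw = Afun q w;
         \<kappa> = kappa q v;
         Q0' = deriv (\<lambda>x. Q0 a w x) q;
         R' = deriv (\<lambda>x. Rfun p w q v x) q;
         S' = deriv (\<lambda>x. Sfun w q v x) q
     in (0,
         1,
         1 / Aw * \<kappa> + 1 / (hbar * Aw) * (2 * p * q * (q - 1)),
         1 / Aw * (q * (q - 1) * S' - v)
           + 1 / (hbar * Aw) * (q * (q - 1) * R' - p - Q0' * \<kappa> / (2 * p) - Aw * dp_dw)))"

text \<open>
  Holomorphic integral curves, with complex time in an open set \<open>D\<close>: the complex
  derivative of \<open>\<gamma>\<close> at \<open>t\<close> is the value \<open>X (\<gamma> t)\<close> of the vector field.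
\<close>

definition integral_curve ::
    "(complex \<times> complex \<times> complex \<times> complex \<Rightarrow> complex \<times> complex \<times> complex \<times> complex) \<Rightarrow>
     (complex \<times> complex \<times> complex \<times> complex) set \<Rightarrow> complex set \<Rightarrow>
     (complex \<Rightarrow> complex \<times> complex \<times> complex \<times> complex) \<Rightarrow> bool" where
  "integral_curve X M D \<gamma> \<longleftrightarrow>
     open D \<and> \<gamma> ` D \<subseteq> M \<and>
     (\<forall>t\<in>D. (\<gamma> has_derivative
        (\<lambda>h. case X (\<gamma> t) of (X1, X2, X3, X4) \<Rightarrow> (h * X1, h * X2, h * X3, h * X4))) (at t))"

end

theory Submission
  imports Defs
begin

text \<open>
  Along an integral curve, \<open>dp/dw\<close> is the partial derivative of \<open>p\<close> plus \<open>Q0'(q) / (2 p)\<close> times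
  \<open>dq/dw\<close>. Hence in the derivative of \<open>u = v + p / \<hbar>\<close> the terms of \<open>V\<close> containing the partial
  derivative of \<open>p\<close> and \<open>Q0' \<kappa> / (2 p)\<close> cancel, the other powers of \<open>1 / \<hbar>\<close> are absorbed by
  replacing \<open>v\<close> with \<open>u\<close> in \<open>S\<close>, and \<open>(q, u)\<close> satisfies the system obtained by
  dropping the \<open>1 / \<hbar>\<close> part of \<open>V\<close>, in which neither \<open>a\<close> nor \<open>p\<close> occurs. Eliminating \<open>u\<close> from
  this system gives the sixth Painleve equation.
\<close>

text \<open>The difference quotient of \<open>f\<close> is that of \<open>g\<close> divided by
  \<open>f y + f x\<close>, which tends to \<open>2 * f x\<close> by continuity. A branch of the
  square root is only assumed continuous; this makes it differentiable both along the integral curve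
  and in \<open>w\<close> alone.\<close>

lemma DERIV_continuous_sqrt:
  fixes f g :: "'a::real_normed_field \<Rightarrow> 'a"
  assumes "open D" "x \<in> D" and cont: "continuous_on D f"
    and sq: "\<And>y. y \<in> D \<Longrightarrow> (f y)^2 = g y"
    and g: "(g has_field_derivative g') (at x)" and nz: "2 * f x \<noteq> 0"
  shows "(f has_field_derivative g' / (2 * f x)) (at x)"
proof -
  have "isCont f x"
    using assms by (simp add: continuous_on_eq_continuous_at)
  then have f: "(f \<longlongrightarrow> f x) (at x)"
    by (simp add: isCont_def)
  then have s: "((\<lambda>y. f y + f x) \<longlongrightarrow> 2 * f x) (at x)"
    by (auto intro!: tendsto_eq_intros)
  have "((\<lambda>y. (g y - g x) / (y - x) / (f y + f x)) \<longlongrightarrow> g' / (2 * f x)) (at x)"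
    using g s nz by (intro tendsto_divide) (auto simp: has_field_derivative_iff)
  moreover have "\<forall>\<^sub>F y in at x. (g y - g x) / (y - x) / (f y + f x) = (f y - f x) / (y - x)"
    using tendsto_imp_eventually_ne[OF s nz] eventually_at_in_open'[OF assms(1,2)]
  proof eventually_elim
    case (elim y)
    moreover have "g y - g x = (f y - f x) * (f y + f x)"
      using sq[OF \<open>y \<in> D\<close>] sq[OF assms(2)]
      by (simp add: square_diff_square_factored power2_eq_square algebra_simps)
    ultimately show ?case
      by (simp add: divide_simps)
  qed
  ultimately have "((\<lambda>y. (f y - f x) / (y - x)) \<longlongrightarrow> g' / (2 * f x)) (at x)"
    by (rule Lim_transform_eventually)
  then show ?thesis
    by (simp add: has_field_derivative_iff)
qed

lemma has_derivative_quadruple_components: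
  fixes a b q v :: "complex \<Rightarrow> complex"
  assumes "((\<lambda>t. (a t, b t, q t, v t)) has_derivative
    (\<lambda>h. (h * X1, h * X2, h * X3, h * X4))) (at t)"
  shows "(a has_field_derivative X1) (at t)" "(q has_field_derivative X3) (at t)"
    "(v has_field_derivative X4) (at t)"
  using has_derivative_fst[OF assms]
    has_derivative_fst[OF has_derivative_snd[OF has_derivative_snd[OF assms]]]
    has_derivative_snd[OF has_derivative_snd[OF has_derivative_snd[OF assms]]]
  by (simp_all add: has_field_derivative_def mult.commute[of _ X1] mult.commute[of _ X3]
      mult.commute[of _ X4])

text \<open>The expansion of \<open>Q0\<close> at infinity starts with \<open>1 / x^3\<close>, so
  over the denominator shared with \<open>Rfun\<close> and \<open>Sfun\<close> the numerator is
  constant in \<open>x\<close>. It also shows that \<open>Q0\<close> has no zeros when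
  \<open>a * w * (w - 1)\<close> is nonzero.\<close>

lemma Q0_eq:
  assumes "x \<notin> {0, 1, w}"
  shows "Q0 a w x = a * w * (w - 1) / (x * (x - 1) * (x - w))"
proof -
  have "x \<noteq> 0" "x - 1 \<noteq> 0" "x - w \<noteq> 0" using assms by auto
  then show ?thesis
    unfolding Q0_def by (simp add: divide_simps) algebra
qed

text \<open>With \<open>e = 1 / \<hbar>\<close> this absorbs the terms of \<open>Q\<close> with negative powers of \<open>\<hbar>\<close> into \<open>v\<close>.\<close>

lemma Sfun_shift:
  assumes "x \<notin> {0, 1, w}" "q \<notin> {0, 1, w}" "p^2 = Q0 a w q"
  shows "Sfun w q (v + e * p) x = Sfun w q v x + e * Rfun p w q v x + e^2 * Q0 a w x"
proof -
  have nz: "q \<noteq> 0" "q - 1 \<noteq> 0" "q - w \<noteq> 0" using assms by auto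
  \<comment> \<open>The left side is the coefficient of \<open>e^2\<close> in the shifted numerator
    of \<open>Sfun\<close>, the right side the numerator of \<open>Q0\<close> at every
    \<open>x\<close>.\<close>
  then have p: "p^2 * (q * (q - 1) * (q - w)) = a * w * (w - 1)"
    using assms(2,3) by (simp add: Q0_eq)
  have "- (v + e * p) * x^2 + ((v + e * p) * (1 + w - q) - 3/4) * x
        + (v + e * p)^2 * q * (q - 1) * (q - w) + q * ((v + e * p) * (2 * q - w - 1) + 3/4)
      = (- v * x^2 + (v * (1 + w - q) - 3/4) * x + v^2 * q * (q - 1) * (q - w)
        + q * (v * (2 * q - w - 1) + 3/4))
      + e * (- p * x^2 + p * (1 + w - q) * x + 2 * p * q^2 - p * q * (1 + w)
        + 2 * p * v * q * (q - 1) * (q - w))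
      + e^2 * (a * w * (w - 1))"
    unfolding p[symmetric] by (simp add: algebra_simps power2_eq_square)
  then show ?thesis
    unfolding Sfun_def Rfun_def Q0_eq[OF assms(1)] by (simp only: times_divide_eq_right flip: add_divide_distrib)
qed

lemma DERIV_Sfun:
  assumes "q \<notin> {0, 1, w}"
  shows "(Sfun w q u has_field_derivative
    (u * (1 + w - 3 * q) - 3/4 - u^2 * (3 * q^2 - 2 * (1 + w) * q + w)) / (q * (q - 1) * (q - w))) (at q)"
proof -
  have nz: "q \<noteq> 0" "q - 1 \<noteq> 0" "q - w \<noteq> 0" using assms by auto
  define d where "d = q * (q - 1) * (q - w)"
  define n where "n = - u * q^2 + (u * (1 + w - q) - 3/4) * q + u^2 * q * (q - 1) * (q - w)
        + q * (u * (2 * q - w - 1) + 3/4)"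
  have d: "d \<noteq> 0" using nz by (simp add: d_def)
  \<comment> \<open>Thus \<open>Sfun\<close> takes the value \<open>u^2\<close> at
    \<open>x = q\<close>, the condition for an apparent singularity there; one factor
    \<open>d\<close> then cancels in the quotient rule.\<close>
  have n: "n = u^2 * d" by (simp add: n_def d_def algebra_simps power2_eq_square)
  have D: "((\<lambda>x. x * (x - 1) * (x - w)) has_field_derivative 3 * q^2 - 2 * (1 + w) * q + w) (at q)"
    by (auto intro!: derivative_eq_intros simp: algebra_simps power2_eq_square)
  have N: "((\<lambda>x. - u * x^2 + (u * (1 + w - q) - 3/4) * x + u^2 * q * (q - 1) * (q - w)
        + q * (u * (2 * q - w - 1) + 3/4)) has_field_derivative u * (1 + w - 3 * q) - 3/4) (at q)"
    by (auto intro!: derivative_eq_intros simp: algebra_simps power2_eq_square)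
  have "(Sfun w q u has_field_derivative
    ((u * (1 + w - 3 * q) - 3/4) * d - n * (3 * q^2 - 2 * (1 + w) * q + w)) / (d * d)) (at q)"
    using DERIV_divide[OF N D] d unfolding Sfun_def[abs_def] d_def n_def by simp
  moreover have "((u * (1 + w - 3 * q) - 3/4) * d - n * (3 * q^2 - 2 * (1 + w) * q + w)) / (d * d)
     = (u * (1 + w - 3 * q) - 3/4 - u^2 * (3 * q^2 - 2 * (1 + w) * q + w)) / d"
    using d by (simp add: n divide_simps) (simp add: algebra_simps)
  ultimately show ?thesis by (simp add: d_def)
qed

lemma field_differentiable_Q0_Rfun_Sfun:
  assumes "x \<notin> {0, 1, w}"
  shows "Q0 a w field_differentiable at x" "Rfun p w q v field_differentiable at x"
    "Sfun w q v field_differentiable at x"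
  using assms unfolding Q0_def[abs_def] Rfun_def[abs_def] Sfun_def[abs_def]
  by (auto intro!: derivative_intros)

text \<open>The shift identity holds for all \<open>x\<close> off the poles with \<open>p\<close>
  and the parameter \<open>q\<close> held fixed, so it may be differentiated in \<open>x\<close>
  before setting \<open>x = q\<close>.\<close>

lemma deriv_Sfun_shift:
  assumes q: "q \<notin> {0, 1, w}" and "p^2 = Q0 a w q"
  shows "deriv (Sfun w q (v + e * p)) q
    = deriv (Sfun w q v) q + e * deriv (Rfun p w q v) q + e^2 * deriv (Q0 a w) q"
proof -
  have "((\<lambda>x. Sfun w q v x + e * Rfun p w q v x + e^2 * Q0 a w x) has_field_derivative
      deriv (Sfun w q v) q + e * deriv (Rfun p w q v) q + e^2 * deriv (Q0 a w) q) (at q)"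
    using field_differentiable_Q0_Rfun_Sfun[OF q]
    by (intro DERIV_add DERIV_cmult) (simp_all add: DERIV_deriv_iff_field_differentiable)
  moreover have "open (- {0, 1, w})" by (simp add: open_Compl finite_imp_closed)
  ultimately have "(Sfun w q (v + e * p) has_field_derivative
      deriv (Sfun w q v) q + e * deriv (Rfun p w q v) q + e^2 * deriv (Q0 a w) q) (at q)"
    using q Sfun_shift[OF _ assms]
    by (elim has_field_derivative_transform_within_open[where S = "- {0, 1, w}"]) auto
  then show ?thesis by (rule DERIV_imp_deriv)
qed

text \<open>The left side is the product rule for \<open>q1\<close>, with \<open>q1\<close> and
  \<open>u1\<close> as derivatives of \<open>q\<close> and \<open>u\<close>. Once both are
  substituted, the claim is an identity of rational functions in \<open>q\<close>, \<open>u\<close>,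
  \<open>t\<close>.\<close>

lemma sixth_Painleve_algebra:
  fixes q u t :: complex
  assumes "q \<notin> {0, 1, t}" "t \<notin> {0, 1}"
    and q1: "q1 = (t - q) / (t * (t - 1)) * (2 * u * q * (q - 1) + 2 * q - 1)"
    and u1: "u1 = (t - q) / (t * (t - 1)) * ((u * (1 + t - 3 * q) - 3/4
      - u^2 * (3 * q^2 - 2 * (1 + t) * q + t)) / (q - t) - u)"
  shows "((1 - q1) * (t * (t - 1)) - (t - q) * (2 * t - 1)) / (t * (t - 1))^2
        * (2 * u * q * (q - 1) + 2 * q - 1)
      + (t - q) / (t * (t - 1)) * (2 * u1 * q * (q - 1) + 2 * u * q1 * (2 * q - 1) + 2 * q1)
    = 1/2 * (1 / q + 1 / (q - 1) + 1 / (q - t)) * q1^2 - (1 / t + 1 / (t - 1) + 1 / (q - t)) * q1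
      + 1/2 * (q * (q - 1) * (q - t) / (t^2 * (t - 1)^2)) * (1 - t / q^2 + (t - 1) / (q - 1)^2)"
proof -
  have nz: "q \<noteq> 0" "q - 1 \<noteq> 0" "q - t \<noteq> 0" "t \<noteq> 0" "t - 1 \<noteq> 0" using assms by auto
  \<comment> \<open>Cancelling \<open>t - q\<close> against \<open>q - t\<close> leaves only
    \<open>t * (t - 1)\<close> in the denominator.\<close>
  have u1': "u1 = (- (u * (1 + t - 3 * q) - 3/4
      - u^2 * (3 * q^2 - 2 * (1 + t) * q + t)) - (t - q) * u) / (t * (t - 1))"
    unfolding u1 using nz by (simp add: divide_simps) algebra
  show ?thesis
    unfolding u1' q1 using nz by (simp add: divide_simps) algebra
qed

lemma integral_curve_V_system:
  fixes hbar :: complex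
  assumes hbar: "hbar \<noteq> 0" and br: "sqrt_branch U p"
    and ic: "integral_curve (V hbar p) {(a, w, q, v). (a, w, q) \<in> U} D (\<lambda>w. (a w, w, q w, v w))"
    and t: "t \<in> D"
    and u_def: "u = (\<lambda>t. v t + 1 / hbar * p (a t, t, q t))"
  shows "q t \<notin> {0, 1, t}" "t \<notin> {0, 1}"
    "(q has_field_derivative
      (t - q t) / (t * (t - 1)) * (2 * u t * q t * (q t - 1) + 2 * q t - 1)) (at t)"
    "(u has_field_derivative
      (t - q t) / (t * (t - 1)) * (q t * (q t - 1) * deriv (Sfun t (q t) (u t)) (q t) - u t)) (at t)"
proof -
  define A where "A = Afun (q t) t"
  define \<kappa> where "\<kappa> = kappa (q t) (v t)"
  define P where "P = p (a t, t, q t)"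
  define Pw where "Pw = deriv (\<lambda>w. p (a t, w, q t)) t"
  define S' where "S' = deriv (Sfun t (q t) (v t)) (q t)"
  define R' where "R' = deriv (Rfun P t (q t) (v t)) (q t)"
  define Qq where "Qq = deriv (Q0 (a t) t) (q t)"
  define q1 where "q1 = 1 / A * \<kappa> + 1 / (hbar * A) * (2 * P * q t * (q t - 1))"
  define v1 where "v1 = 1 / A * (q t * (q t - 1) * S' - v t)
    + 1 / (hbar * A) * (q t * (q t - 1) * R' - P - Qq * \<kappa> / (2 * P) - A * Pw)"
  have D: "open D" and U: "\<And>s. s \<in> D \<Longrightarrow> (a s, s, q s) \<in> U"
    using ic by (auto simp: integral_curve_def)
  have "((\<lambda>w. (a w, w, q w, v w)) has_derivative (\<lambda>h. (h * 0, h * 1, h * q1, h * v1))) (at t)"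
    using ic t
    by (auto simp: integral_curve_def V_def Let_def q1_def v1_def P_def Pw_def S'_def R'_def
        Qq_def A_def \<kappa>_def)
  from has_derivative_quadruple_components[OF this]
  have a: "(a has_field_derivative 0) (at t)" and q: "(q has_field_derivative q1) (at t)"
    and v: "(v has_field_derivative v1) (at t)" .
  have openU: "open U" and contp: "continuous_on U p"
    and sq: "\<And>a w q. (a, w, q) \<in> U \<Longrightarrow> (p (a, w, q))^2 = Q0 a w q"
    and par: "U \<subseteq> parameter_space"
    using br by (auto simp: sqrt_branch_def)
  have nz: "a t \<noteq> 0" "t \<noteq> 0" "t \<noteq> 1" "q t \<noteq> 0" "q t \<noteq> 1" "q t \<noteq> t"
    using U[OF t] par by (auto simp: parameter_space_def)
  then show qt: "q t \<notin> {0, 1, t}" and "t \<notin> {0, 1}" by auto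
  have nz': "t - 1 \<noteq> 0" "q t - 1 \<noteq> 0" "q t - t \<noteq> 0" "t - q t \<noteq> 0" using nz by auto
  have P2: "P^2 = Q0 (a t) t (q t)" unfolding P_def by (rule sq[OF U[OF t]])
  then have P0: "P \<noteq> 0" using qt nz nz' by (auto simp: Q0_eq)
  have A: "1 / A = (t - q t) / (t * (t - 1))" "A \<noteq> 0"
    using nz nz' by (auto simp: A_def Afun_def)
  \<comment> \<open>The partial derivative of \<open>Q0 a w q\<close> in \<open>w\<close> at fixed
    \<open>a\<close> and \<open>q\<close>.\<close>
  define Qw where "Qw = a t / q t - a t / (q t - 1) + a t / (q t - t)^2"
  have "(Q0 (a t) t has_field_derivative
      - (a t * (t - 1)) / (q t)^2 + a t * t / (q t - 1)^2 - a t / (q t - t)^2) (at (q t))"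
    unfolding Q0_def[abs_def] using nz nz'
    by (auto intro!: derivative_eq_intros simp: power2_eq_square)
  then have Qq: "Qq = - (a t * (t - 1)) / (q t)^2 + a t * t / (q t - 1)^2 - a t / (q t - t)^2"
    unfolding Qq_def by (rule DERIV_imp_deriv)
  have dw: "((\<lambda>w. Q0 (a t) w (q t)) has_field_derivative Qw) (at t)"
    unfolding Q0_def Qw_def using nz nz'
    by (auto intro!: derivative_eq_intros simp: power2_eq_square)
  \<comment> \<open>Chain rule; \<open>a\<close> contributes nothing because the first component of
    \<open>V\<close> is zero.\<close>
  have dt: "((\<lambda>s. Q0 (a s) s (q s)) has_field_derivative Qw + Qq * q1) (at t)"
    unfolding Q0_def Qw_def Qq using nz nz'
    by (auto intro!: derivative_eq_intros a q simp: power2_eq_square)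
       (simp add: divide_simps, algebra)
  have contq: "continuous_on D (\<lambda>s. p (a s, s, q s))"
  proof (rule continuous_on_compose2[OF contp])
    have "continuous_on D (\<lambda>s. (a s, s, q s, v s))"
      unfolding continuous_on_eq_continuous_at[OF D]
      using ic by (auto simp: integral_curve_def intro: has_derivative_continuous)
    from continuous_on_fst[OF this] continuous_on_fst[OF continuous_on_snd[OF continuous_on_snd[OF this]]]
    show "continuous_on D (\<lambda>s. (a s, s, q s))"
      by (intro continuous_on_Pair continuous_on_id) simp_all
  qed (use U in auto)
  have p1: "((\<lambda>s. p (a s, s, q s)) has_field_derivative (Qw + Qq * q1) / (2 * P)) (at t)"
    unfolding P_def using P0 sq U
    by (intro DERIV_continuous_sqrt[OF D t contq _ dt]) (auto simp: P_def)
  \<comment> \<open>The slice of \<open>U\<close> on which only \<open>w\<close> varies: the square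
    root lemma applied there yields the partial derivative of \<open>p\<close> that occurs in
    \<open>V\<close>.\<close>
  define W where "W = (\<lambda>w. (a t, w, q t)) -` U"
  have W: "open W" unfolding W_def
    by (intro open_vimage openU continuous_intros)
  have contw: "continuous_on W (\<lambda>w. p (a t, w, q t))"
    by (rule continuous_on_compose2[OF contp]) (auto intro!: continuous_intros simp: W_def)
  have "((\<lambda>w. p (a t, w, q t)) has_field_derivative Qw / (2 * P)) (at t)"
    unfolding P_def using P0 sq U[OF t]
    by (intro DERIV_continuous_sqrt[OF W _ contw _ dw]) (auto simp: P_def W_def)
  then have Pw: "Pw = Qw / (2 * P)" unfolding Pw_def by (rule DERIV_imp_deriv)
  have u: "u t = v t + 1 / hbar * P" by (simp add: u_def P_def)
  \<comment> \<open>\<open>kappa\<close> is affine in \<open>v\<close> with slope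
    \<open>2 * q * (q - 1)\<close>, so the \<open>1 / hbar\<close> term is exactly its change from
    \<open>v\<close> to \<open>u\<close>.\<close>
  have q1: "q1 = 1 / A * (2 * u t * q t * (q t - 1) + 2 * q t - 1)"
    unfolding q1_def u \<kappa>_def kappa_def using hbar A(2) by (simp add: field_simps)
  then show "(q has_field_derivative
      (t - q t) / (t * (t - 1)) * (2 * u t * q t * (q t - 1) + 2 * q t - 1)) (at t)"
    using q A by simp
  have "(u has_field_derivative v1 + 1 / hbar * ((Qw + Qq * q1) / (2 * P))) (at t)"
    unfolding u_def by (intro DERIV_add DERIV_cmult v p1)
  \<comment> \<open>\<open>Qw\<close> cancels the \<open>Pw\<close> term, and the
    \<open>\<kappa>\<close> part of \<open>q1\<close> cancels
    \<open>Qq * \<kappa> / (2 * P)\<close>. The other part of \<open>q1\<close> carries a factor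
    \<open>2 * P / hbar\<close> and gives the term \<open>(1 / hbar)^2 * Qq\<close>;
    \<open>- P / hbar\<close> joins \<open>- v t\<close> to form \<open>- u t\<close>.\<close>
  also have "v1 + 1 / hbar * ((Qw + Qq * q1) / (2 * P))
      = 1 / A * (q t * (q t - 1) * (S' + 1 / hbar * R' + (1 / hbar)^2 * Qq) - u t)"
    unfolding v1_def q1_def u Pw using hbar A(2) P0
    by (simp add: field_simps power2_eq_square)
  also have "S' + 1 / hbar * R' + (1 / hbar)^2 * Qq = deriv (Sfun t (q t) (u t)) (q t)"
    unfolding u deriv_Sfun_shift[OF qt P2] S'_def R'_def Qq_def ..
  finally show "(u has_field_derivative
      (t - q t) / (t * (t - 1)) * (q t * (q t - 1) * deriv (Sfun t (q t) (u t)) (q t) - u t)) (at t)"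
    unfolding A(1) .
qed

theorem proposition10p2:
  fixes hbar :: complex
    and U :: "(complex \<times> complex \<times> complex) set"
    and p :: "complex \<times> complex \<times> complex \<Rightarrow> complex"
    and D :: "complex set"
    and a q v :: "complex \<Rightarrow> complex"
  assumes "hbar \<noteq> 0"
    and "sqrt_branch U p"
    and "integral_curve (V hbar p) {(a, w, q, v). (a, w, q) \<in> U} D (\<lambda>w. (a w, w, q w, v w))"
  shows "\<forall>w\<in>D. (deriv q has_field_derivative
           (1/2 * (1 / q w + 1 / (q w - 1) + 1 / (q w - w)) * (deriv q w)^2
            - (1 / w + 1 / (w - 1) + 1 / (q w - w)) * deriv q w
            + 1/2 * (q w * (q w - 1) * (q w - w) / (w^2 * (w - 1)^2))
                * (1 - w / (q w)^2 + (w - 1) / (q w - 1)^2))) (at w)"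
proof
  fix t assume t: "t \<in> D"
  define u where "u = (\<lambda>t. v t + 1 / hbar * p (a t, t, q t))"
  \<comment> \<open>\<open>c\<close> is the reciprocal of \<open>Afun (q t) t\<close>, and
    \<open>K\<close> is \<open>kappa\<close> evaluated at \<open>u\<close> instead of
    \<open>v\<close>.\<close>
  define c where "c = (\<lambda>t. (t - q t) / (t * (t - 1)))"
  define K where "K = (\<lambda>t. 2 * u t * q t * (q t - 1) + 2 * q t - 1)"
  note sys = integral_curve_V_system[OF assms _ u_def]
  have dq: "(q has_field_derivative c s * K s) (at s)" if "s \<in> D" for s
    using sys(3)[OF that] by (simp add: c_def K_def)
  have q1: "deriv q s = c s * K s" if "s \<in> D" for s
    using dq[OF that] by (rule DERIV_imp_deriv)
  define u1 where "u1 = c t * ((u t * (1 + t - 3 * q t) - 3/4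
      - (u t)^2 * (3 * (q t)^2 - 2 * (1 + t) * q t + t)) / (q t - t) - u t)"
  have nz: "q t \<noteq> 0" "q t - 1 \<noteq> 0" "q t - t \<noteq> 0" "t \<noteq> 0" "t - 1 \<noteq> 0"
    using sys(1,2)[OF t] by auto
  have du: "(u has_field_derivative u1) (at t)"
    using sys(4)[OF t] nz
    by (simp add: u1_def c_def DERIV_imp_deriv[OF DERIV_Sfun[OF sys(1)[OF t]]])
  have dq': "(q has_field_derivative deriv q t) (at t)"
    using dq[OF t] q1[OF t] by simp
  have dc: "(c has_field_derivative
      ((1 - deriv q t) * (t * (t - 1)) - (t - q t) * (2 * t - 1)) / (t * (t - 1))^2) (at t)"
    unfolding c_def using nz
    by (auto intro!: derivative_eq_intros dq' simp: power2_eq_square algebra_simps)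
  have dK: "(K has_field_derivative
      2 * u1 * q t * (q t - 1) + 2 * u t * deriv q t * (2 * q t - 1) + 2 * deriv q t) (at t)"
    unfolding K_def by (auto intro!: derivative_eq_intros dq' du simp: algebra_simps)
  have "open D" using assms(3) by (simp add: integral_curve_def)
  \<comment> \<open>The first equation of the system holds on all of the open set \<open>D\<close>,
    so near \<open>t\<close> the function \<open>deriv q\<close> may be replaced by the product of
    \<open>c\<close> and \<open>K\<close>.\<close>
  have "(deriv q has_field_derivative
      ((1 - deriv q t) * (t * (t - 1)) - (t - q t) * (2 * t - 1)) / (t * (t - 1))^2 * K t
      + c t * (2 * u1 * q t * (q t - 1) + 2 * u t * deriv q t * (2 * q t - 1) + 2 * deriv q t)) (at t)"
    by (rule has_field_derivative_transform_within_open[OF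
          DERIV_mult[OF dc dK, unfolded mult.commute[of _ "c t"]] \<open>open D\<close> t])
       (simp add: q1)
  then show "(deriv q has_field_derivative
           (1/2 * (1 / q t + 1 / (q t - 1) + 1 / (q t - t)) * (deriv q t)^2
            - (1 / t + 1 / (t - 1) + 1 / (q t - t)) * deriv q t
            + 1/2 * (q t * (q t - 1) * (q t - t) / (t^2 * (t - 1)^2))
                * (1 - t / (q t)^2 + (t - 1) / (q t - 1)^2))) (at t)"
    by (rule DERIV_cong)
       (use sixth_Painleve_algebra[OF sys(1)[OF t] sys(2)[OF t] q1[OF t, unfolded c_def K_def]
            u1_def[unfolded c_def]] in \<open>simp only: c_def K_def\<close>)
qed

end
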